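(* Let $(G,\mathsf{ConjEvenParity}(\alpha_1,\dots,\alpha_k))$ be a generalized parity game with priority functions $\alpha_\ell:V\to[d_\ell]$. For some given vector $q=(q_1,\dots,q_k)$ of $0$-priorities $q_\ell\in[d_\ell]$, let $P_{\ge q}=\{d(0),d(0)-2,\dots,q\}$ and let $F^{(0)}=\mathsf{LayEp}_0(G,\alpha_1,\dots,\alpha_k,P_{\ge q})$ (both defined in the context). Then for all $v_0\in V$, if $v_0\in\mathsf{Attr}_0(G,F^{(0)})$, then $v_0\in\mathsf{Win}(G,0,\mathsf{ConjEvenParity}(\alpha_1,\dots,\alpha_k))$.
   Context: A game structure $G=(V_0,V_1,E)$ consists of a finite directed graph $(V,E)$ with $V=V_0\sqcup V_1$ ($V_i$ controlled by player $i$) in which every vertex has an outgoing edge. Plays are infinite paths; $\mathsf{Inf}(\pi)$ is the set of vertices occurring infinitely often in $\pi$. A strategy of player $i$ maps each history (finite path) ending in $V_i$ to a successor of its last vertex. $\mathsf{Win}(G,i,\Omega)$ is the set of vertices $v_0$ from which player $i$ has a strategy such that all plays from $v_0$ consistent with it belong to $\Omega$. With $[d]=\{0,\dots,d\}$ and $k\ge1$, $\mathsf{ConjEvenParity}(\alpha_1,\dots,\alpha_k)$ is the set of plays $\pi$ such that $\max_{v\in\mathsf{Inf}(\pi)}\alpha_\ell(v)$ is even for all $\ell$. A $0$-priority is an even number, a $1$-priority an odd number. $\mathsf{Cpre}_0(G,U)=\{v\in V_0\mid\exists(v,v')\in E,\ v'\in U\}\cup\{v\in V_1\mid\forall(v,v')\in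 E,\ v'\in U\}$. $\mathsf{Attr}_0(G,U)$ is the set of vertices from which player 0 can ensure to visit $U$ in any number of steps (zero included). The positive safe attractor $\mathsf{PSafeAttr}_0(G,U,U')$ is the set of vertices from which player 0 can ensure to visit $U$ in any positive number of steps while visiting no vertex of $U'$ (the starting vertex and the reached vertex of $U$ included); i.e. $\bigcup_{j\ge0}X_j$ with $X_0=\mathsf{Cpre}_0(G,U\setminus U')\setminus U'$ and $X_{j+1}=X_j\cup(\mathsf{Cpre}_0(G,X_j\cup(U\setminus U'))\setminus U')$. Vectors: $d(0)=(d_1(0),\dots,d_k(0))$ where $d_\ell(0)$ is the largest $0$-priority in $[d_\ell]$. For a vector $p$, $p-2=(\max\{p_1-2,q_1\},\dots,\max\{p_k-2,q_k\})$. $P_{\ge q}$ is the finite chain $d(0),d(0)-2,(d(0)-2)-2,\dots$ ending at $q$; for $p\in P_{\ge q}$, $p\neq d(0)$, the notation $p+2$ denotes the element just before $p$ in this chain, and $d(0)+2$ is a formal symbol. For $p\in P_{\ge q}$ and $v\in V$, let $N_p(v)=\{\ell\mid\alpha_\ell(v)\text{ is a }0\text{-priority and }\alpha_\ell(v)\ge p_\ell\}$. The extended structure $G_p$ has vertices $(v,N)$ with $v\in V$, $N\subseteq\{1,\dots,k\}$; player $i$ controls those with $v\in V_i$; its edges are the pairs $((v,N),(v',N'))$ with $(v,v')\in E$ and $N'=N\cup N_p(v')$. For $U\subseteq V$ let $T_p=\{(v,N)\mid v\in U,\ N=\{1,\dots,k\}\}$ and $T'_p=\{(v,N)\mid\exists\ell,\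 \alpha_\ell(v)\text{ is a }1\text{-priority and }\alpha_\ell(v)>p_\ell\}$. Layered attractor: let $C_{d(0)+2}=\emptyset$ and, for $p\in P_{\ge q}$ in the order of the chain, $B_p=\mathsf{PSafeAttr}_0(G_p,\ T_p\cup C_{p+2},\ T'_p\setminus C_{p+2})$ and $C_p=C_{p+2}\cup\{(v,N)\mid N\subseteq\{1,\dots,k\},\ (v,N_p(v))\in B_p\}$. Define $\mathsf{LayAttr}_0(G,\alpha_1,\dots,\alpha_k,P_{\ge q},U)=\{v\in V\mid(v,N_q(v))\in B_q\}$. Finally $\mathsf{LayEp}_0(G,\alpha_1,\dots,\alpha_k,P_{\ge q})=\bigcap_{j\ge0}F_j$, where $F_0=V$ and, for $j\ge1$, $A_j=\mathsf{LayAttr}_0(G,\alpha_1,\dots,\alpha_k,P_{\ge q},F_{j-1})$ and $F_j=A_j\cap F_{j-1}$. *)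

theory Defs
  imports Main "HOL-Library.Omega_Words_Fun"
begin

datatype player = Player0 | Player1

record 'v game =
  verts0 :: "'v set"
  verts1 :: "'v set"
  edges :: "('v \<times> 'v) set"

definition verts :: "'v game \<Rightarrow> 'v set" where
  "verts G = verts0 G \<union> verts1 G"

fun owned :: "'v game \<Rightarrow> player \<Rightarrow> 'v set" where
  "owned G Player0 = verts0 G"
| "owned G Player1 = verts1 G"

definition game_structure :: "'v game \<Rightarrow> bool" where
  "game_structure G \<longleftrightarrow>
     finite (verts G) \<and> verts0 G \<inter> verts1 G = {} \<and>
     edges G \<subseteq> verts G \<times> verts G \<and> (\<forall>v\<in>verts G. \<exists>v'. (v, v') \<in> edges G)"

definition plays :: "'v game \<Rightarrow> 'v word set" where
  "plays G = {\<pi>. \<pi> 0 \<in> verts G \<and> (\<forall>n. (\<pi> n, \<pi> (Suc n)) \<in> edges G)}"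

definition histories :: "'v game \<Rightarrow> 'v list set" where
  "histories G =
     {h. h \<noteq> [] \<and> set h \<subseteq> verts G \<and> successively (\<lambda>u v. (u, v) \<in> edges G) h}"

definition strategy :: "'v game \<Rightarrow> player \<Rightarrow> ('v list \<Rightarrow> 'v) \<Rightarrow> bool" where
  "strategy G i \<sigma> \<longleftrightarrow>
     (\<forall>h\<in>histories G. last h \<in> owned G i \<longrightarrow> (last h, \<sigma> h) \<in> edges G)"

definition consistent :: "'v game \<Rightarrow> player \<Rightarrow> ('v list \<Rightarrow> 'v) \<Rightarrow> 'v word \<Rightarrow> bool" where
  "consistent G i \<sigma> \<pi> \<longleftrightarrow>
     (\<forall>n. \<pi> n \<in> owned G i \<longrightarrow> \<pi> (Suc n) = \<sigma> (prefix (Suc n) \<pi>))"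

definition Win :: "'v game \<Rightarrow> player \<Rightarrow> 'v word set \<Rightarrow> 'v set" where
  "Win G i \<Omega> =
     {v \<in> verts G. \<exists>\<sigma>. strategy G i \<sigma> \<and>
        (\<forall>\<pi>\<in>plays G. \<pi> 0 = v \<and> consistent G i \<sigma> \<pi> \<longrightarrow> \<pi> \<in> \<Omega>)}"

text \<open>
  The \<open>k\<close> priority functions are indexed by a finite type \<open>'k\<close> (so \<open>k = CARD('k) \<ge> 1\<close>), which
  plays the role of \<open>{1, \<dots>, k}\<close>; vectors are functions on \<open>'k\<close>, and \<open>limit \<pi>\<close> is the set of
  vertices occurring infinitely often in \<open>\<pi>\<close>.
\<close>

definition ConjEvenParity ::
    "'v game \<Rightarrow> ('k::finite \<Rightarrow> 'v \<Rightarrow> nat) \<Rightarrow> 'v word set" where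
  "ConjEvenParity G \<alpha> = {\<pi> \<in> plays G. \<forall>l. even (Max (\<alpha> l ` limit \<pi>))}"

definition Cpre0 :: "'v game \<Rightarrow> 'v set \<Rightarrow> 'v set" where
  "Cpre0 G U =
     {v \<in> verts0 G. \<exists>v'. (v, v') \<in> edges G \<and> v' \<in> U} \<union>
     {v \<in> verts1 G. \<forall>v'. (v, v') \<in> edges G \<longrightarrow> v' \<in> U}"

definition Attr0 :: "'v game \<Rightarrow> 'v set \<Rightarrow> 'v set" where
  "Attr0 G U = Win G Player0 {\<pi> \<in> plays G. \<exists>n. \<pi> n \<in> U}"

primrec PSafeAttr0_step :: "'v game \<Rightarrow> 'v set \<Rightarrow> 'v set \<Rightarrow> nat \<Rightarrow> 'v set" where
  "PSafeAttr0_step G U U' 0 = Cpre0 G (U - U') - U'"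
| "PSafeAttr0_step G U U' (Suc j) =
     PSafeAttr0_step G U U' j \<union> (Cpre0 G (PSafeAttr0_step G U U' j \<union> (U - U')) - U')"

definition PSafeAttr0 :: "'v game \<Rightarrow> 'v set \<Rightarrow> 'v set \<Rightarrow> 'v set" where
  "PSafeAttr0 G U U' = (\<Union>j. PSafeAttr0_step G U U' j)"

definition top_even :: "('k \<Rightarrow> nat) \<Rightarrow> 'k \<Rightarrow> nat" where
  "top_even d = (\<lambda>l. Max {m \<in> {0..d l}. even m})"

text \<open>Truncated subtraction is harmless here because of the maximum with \<open>q l \<ge> 0\<close>.\<close>

definition minus_two :: "('k \<Rightarrow> nat) \<Rightarrow> ('k \<Rightarrow> nat) \<Rightarrow> 'k \<Rightarrow> nat" where
  "minus_two q p = (\<lambda>l. max (p l - 2) (q l))"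

text \<open>
  The chain \<open>P\<^sub>\<ge>\<^sub>q\<close> as a list, from \<open>d(0)\<close> down to the first occurrence of \<open>q\<close>.
\<close>

definition chain_above :: "('k \<Rightarrow> nat) \<Rightarrow> ('k \<Rightarrow> nat) \<Rightarrow> ('k \<Rightarrow> nat) list" where
  "chain_above d q =
     map (\<lambda>j. (minus_two q ^^ j) (top_even d))
       [0..<Suc (LEAST j. (minus_two q ^^ j) (top_even d) = q)]"

definition seen_even :: "('k \<Rightarrow> 'v \<Rightarrow> nat) \<Rightarrow> ('k \<Rightarrow> nat) \<Rightarrow> 'v \<Rightarrow> 'k set" where
  "seen_even \<alpha> p v = {l. even (\<alpha> l v) \<and> \<alpha> l v \<ge> p l}"

definition extended ::
    "'v game \<Rightarrow> ('k \<Rightarrow> 'v \<Rightarrow> nat) \<Rightarrow> ('k \<Rightarrow> nat) \<Rightarrow> ('v \<times> 'k set) game" where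
  "extended G \<alpha> p =
     \<lparr> verts0 = verts0 G \<times> UNIV,
       verts1 = verts1 G \<times> UNIV,
       edges = {((v, N), (v', N')). (v, v') \<in> edges G \<and> N' = N \<union> seen_even \<alpha> p v'} \<rparr>"

definition target :: "'v set \<Rightarrow> ('v \<times> 'k set) set" where
  "target U = {(v, N). v \<in> U \<and> N = UNIV}"

definition unsafe ::
    "'v game \<Rightarrow> ('k \<Rightarrow> 'v \<Rightarrow> nat) \<Rightarrow> ('k \<Rightarrow> nat) \<Rightarrow> ('v \<times> 'k set) set" where
  "unsafe G \<alpha> p = {(v, N). v \<in> verts G \<and> (\<exists>l. odd (\<alpha> l v) \<and> \<alpha> l v > p l)}"

text \<open>
  In \<open>layer_B\<close> and \<open>layer_C\<close> the last argument \<open>C\<close> stands for \<open>C\<^bsub>p+2\<^esub>\<close>; the results are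
  \<open>B\<^sub>p\<close> and \<open>C\<^sub>p\<close>.
\<close>

definition layer_B ::
    "'v game \<Rightarrow> ('k::finite \<Rightarrow> 'v \<Rightarrow> nat) \<Rightarrow> 'v set \<Rightarrow> ('k \<Rightarrow> nat) \<Rightarrow>
     ('v \<times> 'k set) set \<Rightarrow> ('v \<times> 'k set) set" where
  "layer_B G \<alpha> U p C =
     PSafeAttr0 (extended G \<alpha> p) (target U \<union> C) (unsafe G \<alpha> p - C)"

definition layer_C ::
    "'v game \<Rightarrow> ('k::finite \<Rightarrow> 'v \<Rightarrow> nat) \<Rightarrow> 'v set \<Rightarrow> ('k \<Rightarrow> nat) \<Rightarrow>
     ('v \<times> 'k set) set \<Rightarrow> ('v \<times> 'k set) set" where
  "layer_C G \<alpha> U p C =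
     C \<union> {(v, N). v \<in> verts G \<and> (v, seen_even \<alpha> p v) \<in> layer_B G \<alpha> U p C}"

text \<open>
  With \<open>P = P\<^sub>\<ge>\<^sub>q\<close> we have \<open>q = last P\<close>, and folding over \<open>butlast P\<close> yields \<open>C\<^bsub>q+2\<^esub>\<close>
  (empty if \<open>q = d(0)\<close>).
\<close>

definition LayAttr0 ::
    "'v game \<Rightarrow> ('k::finite \<Rightarrow> 'v \<Rightarrow> nat) \<Rightarrow> ('k \<Rightarrow> nat) list \<Rightarrow> 'v set \<Rightarrow> 'v set" where
  "LayAttr0 G \<alpha> P U =
     {v \<in> verts G. (v, seen_even \<alpha> (last P) v) \<in>
        layer_B G \<alpha> U (last P) (fold (layer_C G \<alpha> U) (butlast P) {})}"

primrec LayEp0_step ::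
    "'v game \<Rightarrow> ('k::finite \<Rightarrow> 'v \<Rightarrow> nat) \<Rightarrow> ('k \<Rightarrow> nat) list \<Rightarrow> nat \<Rightarrow> 'v set" where
  "LayEp0_step G \<alpha> P 0 = verts G"
| "LayEp0_step G \<alpha> P (Suc j) = LayAttr0 G \<alpha> P (LayEp0_step G \<alpha> P j) \<inter> LayEp0_step G \<alpha> P j"

definition LayEp0 ::
    "'v game \<Rightarrow> ('k::finite \<Rightarrow> 'v \<Rightarrow> nat) \<Rightarrow> ('k \<Rightarrow> nat) list \<Rightarrow> 'v set" where
  "LayEp0 G \<alpha> P = (\<Inter>j. LayEp0_step G \<alpha> P j)"

end

theory Submission
  imports Defs
begin

text \<open>
  The fixed point \<open>F = LayEp\<^sub>0\<close> satisfies \<open>F \<subseteq> LayAttr\<^sub>0(F)\<close>. From a vertex of \<open>F\<close>, player 0 plays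
  in rounds that end in \<open>F\<close> again. She always follows the positive safe attractor of the first layer
  (the one with the largest vector \<open>p\<close>) that contains the current vertex; on entering an earlier
  layer she switches to it and forgets the set \<open>N\<close>. Within a round \<open>p\<close> only increases, so when the
  round ends in the target of layer \<open>p\<close>, every odd \<open>\<ell>\<close>-priority of the round is at most \<open>p\<^sub>\<ell>\<close>,
  and hence below some even \<open>\<ell>\<close>-priority of the same round. The layer index and the attractor rank
  decrease lexicographically, so every round ends.
\<close>

section \<open>Plays, histories, and strategies assembled from them\<close>

lemma plays_in_verts:
  assumes "game_structure G" "\<pi> \<in> plays G"
  shows "\<pi> n \<in> verts G"
  using assms by (cases n) (auto simp: plays_def game_structure_def)

lemma plays_suffix:
  assumes "game_structure G" "\<pi> \<in> plays G"
  shows "suffix k \<pi> \<in> plays G"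
  using plays_in_verts[OF assms] assms(2) by (auto simp: plays_def)

lemma successively_dropWhile: "successively R xs \<Longrightarrow> successively R (dropWhile Q xs)"
  by (induction xs rule: induct_list012) auto

lemma dropWhile_in_histories:
  assumes "h \<in> histories G" "dropWhile Q h \<noteq> []"
  shows "dropWhile Q h \<in> histories G"
  using assms successively_dropWhile[of _ h Q] set_dropWhileD[of _ Q h]
  unfolding histories_def by blast

text \<open>Turns a nondeterministic plan with memory into a strategy. The states \<open>s\<close>
  carry a vertex \<open>f s\<close> plus memory, and \<open>step\<close> describes the allowed moves
  of the plan. Choosing one successor state per observed vertex makes the current state a function
  of the history, so every consistent play lifts to an infinite run of \<open>step\<close>, and only
  such runs have to be shown winning.\<close>

lemma Win_of_simulation:
  fixes f :: "'s \<Rightarrow> 'v"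
  assumes G: "game_structure G" and s0: "I s0" "f s0 \<in> verts G"
    and choose: "\<And>s. I s \<Longrightarrow> f s \<in> verts0 G \<Longrightarrow> \<exists>s'. (f s, f s') \<in> edges G \<and> step s s'"
    and respond: "\<And>s v. I s \<Longrightarrow> f s \<in> verts1 G \<Longrightarrow> (f s, v) \<in> edges G \<Longrightarrow> \<exists>s'. f s' = v \<and> step s s'"
    and invar: "\<And>s s'. I s \<Longrightarrow> step s s' \<Longrightarrow> I s'"
    and win: "\<And>\<pi> \<rho>. \<lbrakk>\<pi> \<in> plays G; \<And>n. f (\<rho> n) = \<pi> n; \<rho> 0 = s0; \<And>n. step (\<rho> n) (\<rho> (Suc n))\<rbrakk> \<Longrightarrow> \<pi> \<in> \<Omega>"
  shows "f s0 \<in> Win G Player0 \<Omega>"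
proof -
  define upd where "upd s v = (SOME s'. f s' = v \<and> step s s')" for s v
  \<comment> \<open>The first vertex of the history is already accounted for by \<open>s0\<close>,
    hence \<open>tl h\<close>.\<close>
  define state where "state h = foldl upd s0 (tl h)" for h
  define good where "good h v \<longleftrightarrow> (last h, v) \<in> edges G \<and> (\<exists>s'. f s' = v \<and> step (state h) s')" for h v
  \<comment> \<open>The fallback edge covers histories on which the plan offers no move; a strategy
    has to be legal on these too.\<close>
  define \<sigma> where "\<sigma> h = (if \<exists>v. good h v then SOME v. good h v else SOME v. (last h, v) \<in> edges G)" for h
  have \<sigma>_good: "good h (\<sigma> h)" if "good h v" for h v
    using that someI[of "good h" v] by (auto simp: \<sigma>_def)
  have "strategy G Player0 \<sigma>"
    unfolding strategy_def
  proof (intro ballI impI)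
    fix h assume "h \<in> histories G" "last h \<in> owned G Player0"
    then have "\<exists>v. (last h, v) \<in> edges G"
      using G by (auto simp: game_structure_def verts_def)
    then have "(last h, SOME v. (last h, v) \<in> edges G) \<in> edges G"
      by (rule someI_ex)
    then show "(last h, \<sigma> h) \<in> edges G"
      using \<sigma>_good[of h] by (cases "\<exists>v. good h v") (auto simp: good_def \<sigma>_def)
  qed
  moreover have "\<pi> \<in> \<Omega>" if \<pi>: "\<pi> \<in> plays G" "\<pi> 0 = f s0" "consistent G Player0 \<sigma> \<pi>" for \<pi>
  proof -
    define \<rho> where "\<rho> n = state (prefix (Suc n) \<pi>)" for n
    have \<rho>0: "\<rho> 0 = s0"
      by (simp add: \<rho>_def state_def subsequence_def)
    have \<rho>_Suc: "\<rho> (Suc n) = upd (\<rho> n) (\<pi> (Suc n))" for n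
      by (simp add: \<rho>_def state_def subsequence_def tl_append split: list.split)
    have step: "f (\<rho> (Suc n)) = \<pi> (Suc n) \<and> step (\<rho> n) (\<rho> (Suc n))"
      if inv: "f (\<rho> n) = \<pi> n" "I (\<rho> n)" for n
    proof -
      have last: "last (prefix (Suc n) \<pi>) = \<pi> n"
        by (simp add: subsequence_def)
      have edge: "(\<pi> n, \<pi> (Suc n)) \<in> edges G"
        using \<pi>(1) by (simp add: plays_def)
      have "\<exists>s'. f s' = \<pi> (Suc n) \<and> step (\<rho> n) s'"
      proof (cases "\<pi> n \<in> verts0 G")
        case True
        then obtain s' where "(\<pi> n, f s') \<in> edges G" "step (\<rho> n) s'"
          using choose[of "\<rho> n"] inv by auto
        then have "good (prefix (Suc n) \<pi>) (f s')"
          unfolding good_def last using \<rho>_def by auto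
        then have "good (prefix (Suc n) \<pi>) (\<pi> (Suc n))"
          using \<sigma>_good \<pi>(3) True by (auto simp: consistent_def)
        then show ?thesis
          by (auto simp: good_def \<rho>_def)
      next
        case False
        then have "\<pi> n \<in> verts1 G"
          using plays_in_verts[OF G \<pi>(1), of n] by (simp add: verts_def)
        then show ?thesis
          using respond inv edge by auto
      qed
      then show ?thesis
        unfolding \<rho>_Suc upd_def by (rule someI_ex)
    qed
    have inv: "f (\<rho> n) = \<pi> n \<and> I (\<rho> n)" for n
    proof (induction n)
      case 0
      then show ?case using \<pi>(2) s0 \<rho>0 by simp
    next
      case (Suc n)
      then show ?case using step invar by blast
    qed
    show ?thesis
      using win[of \<pi> \<rho>] \<pi>(1) inv \<rho>0 step by blast
  qed
  ultimately show ?thesis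
    using s0(2) by (auto simp: Win_def)
qed

text \<open>Player 0 follows the attractor strategy until the first visit to \<open>F\<close>, then
  the winning strategy of the vertex reached there, feeding it only the part of the history from
  that visit on. The resulting suffix is in \<Omega>, and closure under prepending a finite path
  gives the whole play.\<close>

lemma Win_of_Attr0:
  assumes G: "game_structure G" and v0: "v0 \<in> Attr0 G F"
    and F: "F \<subseteq> Win G Player0 \<Omega>"
    and suffix_closed: "\<And>\<pi> k. \<pi> \<in> plays G \<Longrightarrow> suffix k \<pi> \<in> \<Omega> \<Longrightarrow> \<pi> \<in> \<Omega>"
  shows "v0 \<in> Win G Player0 \<Omega>"
proof -
  from v0 obtain \<sigma> where v0_verts: "v0 \<in> verts G" and \<sigma>: "strategy G Player0 \<sigma>"
    and reach: "\<And>\<pi>. \<lbrakk>\<pi> \<in> plays G; \<pi> 0 = v0; consistent G Player0 \<sigma> \<pi>\<rbrakk> \<Longrightarrow> \<exists>n. \<pi> n \<in> F"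
    by (auto simp: Attr0_def Win_def)
  from F have "\<forall>u\<in>F. \<exists>\<tau>. strategy G Player0 \<tau> \<and>
      (\<forall>\<pi>\<in>plays G. \<pi> 0 = u \<and> consistent G Player0 \<tau> \<pi> \<longrightarrow> \<pi> \<in> \<Omega>)"
    by (auto simp: Win_def)
  then obtain \<tau> where \<tau>: "\<And>u. u \<in> F \<Longrightarrow> strategy G Player0 (\<tau> u)"
    and \<tau>_win: "\<And>u \<pi>. \<lbrakk>u \<in> F; \<pi> \<in> plays G; \<pi> 0 = u; consistent G Player0 (\<tau> u) \<pi>\<rbrakk> \<Longrightarrow> \<pi> \<in> \<Omega>"
    by metis
  define cut where "cut h = dropWhile (\<lambda>v. v \<notin> F) h" for h
  define \<upsilon> where "\<upsilon> h = (if cut h = [] then \<sigma> h else \<tau> (hd (cut h)) (cut h))" for h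
  have "strategy G Player0 \<upsilon>"
    unfolding strategy_def
  proof (intro ballI impI)
    fix h assume h: "h \<in> histories G" "last h \<in> owned G Player0"
    show "(last h, \<upsilon> h) \<in> edges G"
    proof (cases "cut h = []")
      case True
      then show ?thesis using \<sigma> h by (simp add: \<upsilon>_def strategy_def)
    next
      case False
      have "hd (cut h) \<in> F"
        using hd_dropWhile[of "\<lambda>v. v \<notin> F" h] False by (auto simp: cut_def)
      moreover have "cut h \<in> histories G"
        using dropWhile_in_histories[OF h(1)] False by (simp add: cut_def)
      moreover have "last (cut h) = last h"
        using False takeWhile_dropWhile_id[of "\<lambda>v. v \<notin> F" h] last_appendR
        unfolding cut_def by metis
      ultimately show ?thesis
        using \<tau> h(2) False by (fastforce simp: \<upsilon>_def strategy_def)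
    qed
  qed
  moreover have "\<pi> \<in> \<Omega>" if \<pi>: "\<pi> \<in> plays G" "\<pi> 0 = v0" "consistent G Player0 \<upsilon> \<pi>" for \<pi>
  proof -
    have "\<exists>n. \<pi> n \<in> F"
    proof (rule ccontr)
      assume "\<nexists>n. \<pi> n \<in> F"
      \<comment> \<open>Before any visit to \<open>F\<close> the combined strategy is \<sigma>, so a
        play that never meets \<open>F\<close> would be consistent with \<sigma> and contradict
        \<open>reach\<close>.\<close>
      then have "cut (prefix n \<pi>) = []" for n
        by (auto simp: cut_def subsequence_def)
      then have "\<upsilon> (prefix n \<pi>) = \<sigma> (prefix n \<pi>)" for n
        unfolding \<upsilon>_def by simp
      then have "consistent G Player0 \<sigma> \<pi>"
        using \<pi>(3) by (simp only: consistent_def simp_thms)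
      then show False
        using reach \<pi> \<open>\<nexists>n. \<pi> n \<in> F\<close> by blast
    qed
    then obtain k where k: "\<pi> k \<in> F" and least: "\<And>i. i < k \<Longrightarrow> \<pi> i \<notin> F"
      by (subst (asm) exists_least_iff) blast
    have hd: "hd (prefix m (suffix k \<pi>)) = \<pi> k" if "m > 0" for m
      using that by (simp add: hd_conv_nth)
    \<comment> \<open>Positivity of \<open>m\<close> ensures that the history contains position
      \<open>k\<close>; shorter ones are cut to the empty list.\<close>
    have cut_prefix: "cut (prefix (k + m) \<pi>) = prefix m (suffix k \<pi>)" if "m > 0" for m
    proof -
      have "prefix (k + m) \<pi> = prefix k \<pi> @ prefix m (suffix k \<pi>)"
        by (simp add: subsequence_append)
      moreover have "cut (prefix k \<pi> @ ys) = cut ys" for ys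
        unfolding cut_def using least by (intro dropWhile_append2) (auto simp: subsequence_def)
      moreover have "cut (prefix m (suffix k \<pi>)) = prefix m (suffix k \<pi>)"
        using hd[OF that] k unfolding cut_def dropWhile_eq_self_iff by simp
      ultimately show ?thesis
        by simp
    qed
    have \<upsilon>_prefix: "\<upsilon> (prefix (k + m) \<pi>) = \<tau> (\<pi> k) (prefix m (suffix k \<pi>))" if "m > 0" for m
      using that unfolding \<upsilon>_def cut_prefix[OF that] hd[OF that] by simp
    have "suffix k \<pi> (Suc n) = \<tau> (\<pi> k) (prefix (Suc n) (suffix k \<pi>))"
      if "suffix k \<pi> n \<in> owned G Player0" for n
      using \<pi>(3) that \<upsilon>_prefix[of "Suc n"] unfolding consistent_def
      by (metis add_Suc_right suffix_nth zero_less_Suc)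
    then have "consistent G Player0 (\<tau> (\<pi> k)) (suffix k \<pi>)"
      by (simp add: consistent_def)
    then have "suffix k \<pi> \<in> \<Omega>"
      using \<tau>_win[OF k plays_suffix[OF G \<pi>(1)]] by simp
    then show ?thesis
      using suffix_closed \<pi>(1) by blast
  qed
  ultimately show ?thesis
    using v0_verts by (auto simp: Win_def)
qed

section \<open>Sufficient conditions for the conjunction of parities\<close>

lemma ConjEvenParity_of_suffix:
  assumes "\<pi> \<in> plays G" "suffix k \<pi> \<in> ConjEvenParity G \<alpha>"
  shows "\<pi> \<in> ConjEvenParity G \<alpha>"
  using assms by (simp add: ConjEvenParity_def)

text \<open>Far enough out, only vertices of \<open>limit \<pi>\<close> occur. If the maximal
  priority there were odd, it would recur after \<open>a\<close> and so be exceeded at some position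
  after \<open>a\<close>, again by a vertex of \<open>limit \<pi>\<close>. The exceeding position
  may precede \<open>n\<close>, and its priority may have either parity.\<close>

lemma ConjEvenParity_of_domination:
  assumes G: "game_structure G" and \<pi>: "\<pi> \<in> plays G"
    and dom: "\<And>K. \<exists>a\<ge>K. \<forall>l. \<forall>n\<ge>a. odd (\<alpha> l (\<pi> n)) \<longrightarrow> (\<exists>s\<ge>a. \<alpha> l (\<pi> n) < \<alpha> l (\<pi> s))"
  shows "\<pi> \<in> ConjEvenParity G \<alpha>"
proof -
  have "finite (range \<pi>)"
    using plays_in_verts[OF G \<pi>] G finite_subset[of "range \<pi>" "verts G"]
    by (auto simp: game_structure_def)
  then obtain k where k: "limit \<pi> = range (suffix k \<pi>)" and fin: "finite (limit \<pi>)"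
      and ne: "limit \<pi> \<noteq> {}"
    using limit_is_suffix[of \<pi>] limit_nonempty[of \<pi>] finite_subset[OF limit_in_range[of \<pi>]] by blast
  have "even (Max (\<alpha> l ` limit \<pi>))" for l
  proof (rule ccontr)
    assume odd: "odd (Max (\<alpha> l ` limit \<pi>))"
    have "Max (\<alpha> l ` limit \<pi>) \<in> \<alpha> l ` limit \<pi>"
      using fin ne by simp
    then obtain v where v: "v \<in> limit \<pi>" "\<alpha> l v = Max (\<alpha> l ` limit \<pi>)"
      by auto
    obtain a where a: "a \<ge> k"
        "\<And>n. n \<ge> a \<Longrightarrow> odd (\<alpha> l (\<pi> n)) \<Longrightarrow> \<exists>s\<ge>a. \<alpha> l (\<pi> n) < \<alpha> l (\<pi> s)"
      using dom[of k] by blast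
    obtain n where "n > a" "\<pi> n = v"
      using v(1) by (auto simp: limit_def INFM_nat)
    then obtain s where s: "s \<ge> a" "Max (\<alpha> l ` limit \<pi>) < \<alpha> l (\<pi> s)"
      using a(2)[of n] odd v(2) by auto
    then have "\<pi> s \<in> limit \<pi>"
      using a(1) unfolding k by (auto intro!: image_eqI[of _ _ "s - k"])
    then show False
      using s(2) fin by (meson Max_ge finite_imageI image_eqI not_less)
  qed
  then show ?thesis
    using \<pi> by (simp add: ConjEvenParity_def)
qed

section \<open>Attractor ranks, layers and the fixed point\<close>

text \<open>The rank is the first stage containing the vertex. A vertex new at stage
  \<open>Suc j\<close> must come from the \<open>Cpre0\<close> part, whose attractor vertices lie in
  stage \<open>j\<close> and so have smaller rank; this is the progress measure inside one
  layer.\<close>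

lemma PSafeAttr0_rank:
  "\<exists>r :: 'v \<Rightarrow> nat. \<forall>x\<in>PSafeAttr0 G U U'.
     x \<notin> U' \<and> x \<in> Cpre0 G ({y \<in> PSafeAttr0 G U U'. r y < r x} \<union> (U - U'))"
proof (intro exI ballI)
  define r where "r x = (LEAST j. x \<in> PSafeAttr0_step G U U' j)" for x
  fix x assume "x \<in> PSafeAttr0 G U U'"
  then obtain j where "x \<in> PSafeAttr0_step G U U' j"
    by (auto simp: PSafeAttr0_def)
  then have rx: "x \<in> PSafeAttr0_step G U U' (r x)"
    unfolding r_def by (rule LeastI)
  have mono: "Cpre0 G Y \<subseteq> Cpre0 G Z" if "Y \<subseteq> Z" for Y Z
    using that by (auto simp: Cpre0_def)
  show "x \<notin> U' \<and> x \<in> Cpre0 G ({y \<in> PSafeAttr0 G U U'. r y < r x} \<union> (U - U'))"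
  proof (cases "r x")
    case 0
    then show ?thesis
      using rx mono[of "U - U'" "{y \<in> PSafeAttr0 G U U'. r y < r x} \<union> (U - U')"] by auto
  next
    case (Suc j)
    then have "x \<notin> PSafeAttr0_step G U U' j"
      using not_less_Least[of j "\<lambda>j. x \<in> PSafeAttr0_step G U U' j"] by (simp add: r_def)
    moreover have "PSafeAttr0_step G U U' j \<subseteq> {y \<in> PSafeAttr0 G U U'. r y < r x}"
      unfolding Suc by (auto simp: PSafeAttr0_def r_def less_Suc_eq_le intro: Least_le)
    ultimately show ?thesis
      using rx Suc mono[of "PSafeAttr0_step G U U' j \<union> (U - U')"
          "{y \<in> PSafeAttr0 G U U'. r y < r x} \<union> (U - U')"]
      by auto
  qed
qed

text \<open>For \<open>p = P ! i\<close>, the value at \<open>i\<close> is the set C of the entry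
  just before \<open>p\<close>, so the index is shifted by one against the chain: the C of
  \<open>P ! i\<close> itself sits at \<open>Suc i\<close>.\<close>

definition layers ::
    "'v game \<Rightarrow> ('k::finite \<Rightarrow> 'v \<Rightarrow> nat) \<Rightarrow> 'v set \<Rightarrow> ('k \<Rightarrow> nat) list \<Rightarrow> nat \<Rightarrow> ('v \<times> 'k set) set" where
  "layers G \<alpha> U P i = fold (layer_C G \<alpha> U) (take i P) {}"

lemma layers_0: "layers G \<alpha> U P 0 = {}"
  by (simp add: layers_def)

lemma layers_Suc:
  "i < length P \<Longrightarrow> layers G \<alpha> U P (Suc i) = layer_C G \<alpha> U (P ! i) (layers G \<alpha> U P i)"
  by (simp add: layers_def take_Suc_conv_app_nth)

text \<open>\<open>layer_C\<close> leaves the set component unconstrained. This is what permits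
  resetting it on entering an earlier layer.\<close>

lemma layers_cylinder:
  "i \<le> length P \<Longrightarrow> (v, N) \<in> layers G \<alpha> U P i \<Longrightarrow> (v, N') \<in> layers G \<alpha> U P i"
  by (induction i) (auto simp: layers_0 layers_Suc layer_C_def)

text \<open>Supplies the state after a reset: the smallest layer containing the vertex, with the set
  holding just the indices seen at that vertex. Minimality is the second conjunct, available for the
  reset set by \<open>layers_cylinder\<close>.\<close>

lemma layers_first:
  "i \<le> length P \<Longrightarrow> (v, N) \<in> layers G \<alpha> U P i \<Longrightarrow>
    \<exists>j<i. (v, seen_even \<alpha> (P ! j) v) \<in> layer_B G \<alpha> U (P ! j) (layers G \<alpha> U P j) \<and>
      (v, seen_even \<alpha> (P ! j) v) \<notin> layers G \<alpha> U P j"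
proof (induction i)
  case 0
  then show ?case by (simp add: layers_0)
next
  case (Suc i)
  show ?case
  proof (cases "(v, N) \<in> layers G \<alpha> U P i")
    case True
    with Suc show ?thesis by (meson Suc_leD less_SucI)
  next
    case False
    then have "(v, seen_even \<alpha> (P ! i) v) \<notin> layers G \<alpha> U P i"
      using layers_cylinder Suc.prems(1) by (meson Suc_leD)
    with False Suc.prems show ?thesis
      by (auto simp: layers_Suc layer_C_def)
  qed
qed

lemma Cpre0_extended:
  "(v, N) \<in> Cpre0 (extended G \<alpha> p) Y \<Longrightarrow> v \<in> verts0 G \<Longrightarrow> verts0 G \<inter> verts1 G = {} \<Longrightarrow>
     \<exists>v'. (v, v') \<in> edges G \<and> (v', N \<union> seen_even \<alpha> p v') \<in> Y"
  "(v, N) \<in> Cpre0 (extended G \<alpha> p) Y \<Longrightarrow> v \<in> verts1 G \<Longrightarrow> verts0 G \<inter> verts1 G = {} \<Longrightarrow>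
     (v, v') \<in> edges G \<Longrightarrow> (v', N \<union> seen_even \<alpha> p v') \<in> Y"
  by (auto simp: Cpre0_def extended_def)

text \<open>A decreasing sequence of finite sets is constant from a stage of least cardinality on;
  there the intersection with the previous stage yields the inclusion.\<close>

lemma LayEp0_fixpoint:
  assumes "finite (verts G)"
  shows "LayEp0 G \<alpha> P \<subseteq> LayAttr0 G \<alpha> P (LayEp0 G \<alpha> P)"
proof -
  let ?F = "LayEp0_step G \<alpha> P"
  have sub: "?F j \<subseteq> verts G" for j
    by (induction j) auto
  have anti: "?F j \<subseteq> ?F i" if "i \<le> j" for i j
    using that by (induction rule: dec_induct) auto
  obtain m where m: "\<And>j. card (?F m) \<le> card (?F j)"
    using exists_least_iff[of "\<lambda>c. \<exists>j. c = card (?F j)"] by (metis linorder_not_le)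
  have stable: "?F j = ?F m" if "m \<le> j" for j
    using card_subset_eq[OF finite_subset[OF sub assms] anti[OF that]] m[of j]
      card_mono[OF finite_subset[OF sub assms] anti[OF that]] by simp
  have "?F m \<subseteq> ?F j" for j
    using anti[of j m] stable[of j] by (cases "m \<le> j") auto
  then have "LayEp0 G \<alpha> P = ?F m"
    by (auto simp: LayEp0_def)
  moreover have "?F (Suc m) = ?F m"
    by (rule stable) simp
  ultimately show ?thesis
    by auto
qed


section \<open>The winning strategy on a post-fixed point\<close>

text \<open>The entries of \<open>P\<close> being even makes an odd priority that is at most
  \<open>p l\<close> strictly smaller than \<open>p l\<close>; their descent lets such a bound
  survive a move to an earlier layer.\<close>

lemma postfixpoint_LayAttr0_subset_Win:
  fixes G :: "'v game" and \<alpha> :: "'k::finite \<Rightarrow> 'v \<Rightarrow> nat"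
  assumes G: "game_structure G"
    and U: "U \<subseteq> LayAttr0 G \<alpha> P U"
    and P: "P \<noteq> []"
    and even_P: "\<And>i l. i < length P \<Longrightarrow> even ((P ! i) l)"
    and desc_P: "\<And>i j l. i \<le> j \<Longrightarrow> j < length P \<Longrightarrow> (P ! j) l \<le> (P ! i) l"
  shows "U \<subseteq> Win G Player0 (ConjEvenParity G \<alpha>)"
proof
  let ?D = "layers G \<alpha> U P"
  define B where "B i = layer_B G \<alpha> U (P ! i) (?D i)" for i
  define M where "M i N v = N \<union> seen_even \<alpha> (P ! i) v" for i N v
  have "\<forall>i. \<exists>r. \<forall>x\<in>B i. x \<notin> unsafe G \<alpha> (P ! i) - ?D i \<and>
      x \<in> Cpre0 (extended G \<alpha> (P ! i))
        ({y \<in> B i. (r y::nat) < r x} \<union> (target U \<union> ?D i - (unsafe G \<alpha> (P ! i) - ?D i)))"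
    unfolding B_def layer_B_def by (intro allI PSafeAttr0_rank)
  from choice[OF this] obtain r :: "nat \<Rightarrow> 'v \<times> 'k set \<Rightarrow> nat" where
    B_safe: "\<And>i x. x \<in> B i \<Longrightarrow> x \<notin> unsafe G \<alpha> (P ! i) - ?D i" and
    B_Cpre: "\<And>i x. x \<in> B i \<Longrightarrow> x \<in> Cpre0 (extended G \<alpha> (P ! i))
        ({y \<in> B i. r i y < r i x} \<union> (target U \<union> ?D i - (unsafe G \<alpha> (P ! i) - ?D i)))"
    by blast
  define safe where "safe i v \<longleftrightarrow> (\<forall>l. odd (\<alpha> l v) \<longrightarrow> \<alpha> l v \<le> (P ! i) l)" for i v
  \<comment> \<open>A state is a layer index, the set of indices collected since the last reset, and
    the current vertex. Excluding \<open>?D i\<close> says that \<open>i\<close> is the first layer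
    containing the vertex.\<close>
  define I where "I = (\<lambda>(i, N, v). i < length P \<and> (v, N) \<in> B i - ?D i)"
  \<comment> \<open>The new vertex is judged by the old layer \<open>i\<close>, although the next
    round starts in a layer \<open>i'\<close> that may lie anywhere in the chain.\<close>
  define round_end where "round_end = (\<lambda>(i, N, v :: 'v) (i', N', v').
    M i N v' = UNIV \<and> safe i v' \<and> N' = seen_even \<alpha> (P ! i') v')"
  define climb where "climb = (\<lambda>(i :: nat, N :: 'k set, v :: 'v) (i', N', v').
    i' < i \<and> N' = seen_even \<alpha> (P ! i') v')"
  define continue where "continue = (\<lambda>(i, N, v) (i', N', v').
    i' = i \<and> N' = M i N v' \<and> r i (v', N') < r i (v, N))"
  define step where "step s s' \<longleftrightarrow> I s \<and> I s' \<and> (round_end s s' \<or> climb s s' \<or> continue s s')" for s s'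

  have safe_I: "v \<in> verts G \<and> safe i v" if "I (i, N, v)" for i N v
    using that B_safe[of "(v, N)" i] B_Cpre[of "(v, N)" i]
    by (fastforce simp: I_def safe_def unsafe_def Cpre0_def extended_def verts_def)
  have enter: "\<exists>j N'. N' = seen_even \<alpha> (P ! j) v \<and> I (j, N', v)" if "v \<in> U" for v
  proof -
    \<comment> \<open>\<open>LayAttr0\<close> speaks of B for the last entry; one further
      \<open>layer_C\<close> places the vertex in the full union of layers, where
      \<open>layers_first\<close> applies.\<close>
    have "butlast P = take (length P - 1) P" "last P = P ! (length P - 1)"
      using P by (simp_all add: butlast_conv_take last_conv_nth)
    then have "(v, N) \<in> ?D (Suc (length P - 1))" for N
      unfolding layers_Suc[OF diff_less[OF zero_less_one length_greater_0_conv[THEN iffD2, OF P]]]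
      using that U by (auto simp: LayAttr0_def layer_C_def layers_def)
    then show ?thesis
      using layers_first[of "length P" P v "{}" G \<alpha> U] P by (auto simp: I_def B_def)
  qed
  have advance: "\<exists>s'. snd (snd s') = v' \<and> step (i, N, v) s'"
    if I: "I (i, N, v)" and v': "v' \<in> verts G"
      and succ: "(v', M i N v') \<in> {y \<in> B i. r i y < r i (v, N)} \<union>
        (target U \<union> ?D i - (unsafe G \<alpha> (P ! i) - ?D i))"
    for i N v v'
  \<comment> \<open>Earlier layers take precedence even over the target. Outside \<open>?D i\<close>
    the forbidden set is the plain unsafe set, and \<open>continue\<close> preserves the minimality
    in \<open>I\<close>.\<close>
  proof (cases "(v', M i N v') \<in> ?D i")
    case True
    then obtain j where "j < i" "(v', seen_even \<alpha> (P ! j) v') \<in> B j - ?D j"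
      using layers_first[of i P v' _ G \<alpha> U] I by (auto simp: I_def B_def)
    then have "step (i, N, v) (j, seen_even \<alpha> (P ! j) v', v')"
      using I by (simp add: step_def climb_def I_def)
    then show ?thesis by force
  next
    case notD: False
    show ?thesis
    proof (cases "(v', M i N v') \<in> target U - unsafe G \<alpha> (P ! i)")
      case True
      then have "M i N v' = UNIV" "safe i v'" "v' \<in> U"
        using v' by (auto simp: target_def unsafe_def safe_def not_less)
      then show ?thesis
        using enter[of v'] I by (force simp: step_def round_end_def)
    next
      case False
      then have "step (i, N, v) (i, M i N v', v')"
        using I succ notD by (auto simp: step_def continue_def I_def)
      then show ?thesis by force
    qed
  qed

  fix v0 assume "v0 \<in> U"
  then obtain i0 N0 where s0: "I (i0, N0, v0)"
    using enter by blast
  have "snd (snd (i0, N0, v0)) \<in> Win G Player0 (ConjEvenParity G \<alpha>)"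
  proof (rule Win_of_simulation[where I = I and step = step, OF G s0])
    show "snd (snd (i0, N0, v0)) \<in> verts G"
      using safe_I s0 by simp
  next
    fix s assume "I s" "snd (snd s) \<in> verts0 G"
    then show "\<exists>s'. (snd (snd s), snd (snd s')) \<in> edges G \<and> step s s'"
    proof (cases s)
      case (fields i N v)
      have "(v, N) \<in> B i" "v \<in> verts0 G"
        using \<open>I s\<close> \<open>snd (snd s) \<in> verts0 G\<close> fields by (auto simp: I_def)
      then obtain v' where v': "(v, v') \<in> edges G" "(v', M i N v') \<in> {y \<in> B i. r i y < r i (v, N)} \<union>
          (target U \<union> ?D i - (unsafe G \<alpha> (P ! i) - ?D i))"
        using Cpre0_extended(1)[OF B_Cpre] G unfolding game_structure_def M_def by blast
      then have "v' \<in> verts G"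
        using G by (auto simp: game_structure_def)
      with v' show ?thesis
        using advance[of i N v v'] \<open>I s\<close> fields by auto
    qed
  next
    fix s v' assume "I s" "snd (snd s) \<in> verts1 G" "(snd (snd s), v') \<in> edges G"
    then show "\<exists>s'. snd (snd s') = v' \<and> step s s'"
    proof (cases s)
      case (fields i N v)
      have v: "(v, N) \<in> B i" "v \<in> verts1 G" "(v, v') \<in> edges G"
        using \<open>I s\<close> \<open>snd (snd s) \<in> verts1 G\<close> \<open>(snd (snd s), v') \<in> edges G\<close> fields
        by (auto simp: I_def)
      then have "(v', M i N v') \<in> {y \<in> B i. r i y < r i (v, N)} \<union>
          (target U \<union> ?D i - (unsafe G \<alpha> (P ! i) - ?D i))"
        using Cpre0_extended(2)[OF B_Cpre] G unfolding game_structure_def M_def by blast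
      moreover have "v' \<in> verts G"
        using v G by (auto simp: game_structure_def)
      ultimately show ?thesis
        using advance[of i N v v'] \<open>I s\<close> fields by auto
    qed
  next
    fix s s' assume "step s s'"
    then show "I s'" by (simp add: step_def)
  next
    fix \<pi> \<rho>
    assume \<pi>: "\<pi> \<in> plays G" and proj: "\<And>n. snd (snd (\<rho> n)) = \<pi> n"
      and run: "\<And>n. step (\<rho> n) (\<rho> (Suc n))"
    define i where "i n = fst (\<rho> n)" for n
    define N where "N n = fst (snd (\<rho> n))" for n
    have \<rho>: "\<rho> n = (i n, N n, \<pi> n)" for n
      by (simp add: i_def N_def flip: proj)
    have I: "I (i n, N n, \<pi> n)" for n
      using run[of n] by (simp add: step_def \<rho>)
    have i_bound: "i n < length P" for n
      using I[of n] by (simp add: I_def)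
    have often: "\<exists>n\<ge>K. round_end (\<rho> n) (\<rho> (Suc n))" for K
    proof (rule ccontr)
      assume "\<not> ?thesis"
      then have "climb (\<rho> (K + n)) (\<rho> (Suc (K + n))) \<or> continue (\<rho> (K + n)) (\<rho> (Suc (K + n)))" for n
        using run[of "K + n"] by (auto simp: step_def)
      \<comment> \<open>Without round ends, \<open>climb\<close> lowers the layer index and
        \<open>continue\<close> lowers the rank in a fixed layer.\<close>
      moreover define f where "f n = (i (K + n), r (i (K + n)) (\<pi> (K + n), N (K + n)))" for n
      ultimately have "(f (Suc n), f n) \<in> less_than <*lex*> less_than" for n
        by (fastforce simp: \<rho> climb_def continue_def)
      moreover have "wf (less_than <*lex*> less_than)"
        by (intro wf_lex_prod wf_less_than)
      ultimately show False
        using wf_no_infinite_down_chainE[of "less_than <*lex*> less_than" f] by blast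
    qed
    have dominated: "\<exists>s\<ge>a. \<alpha> l (\<pi> n) < \<alpha> l (\<pi> s)"
      if start: "N a = seen_even \<alpha> (P ! i a) (\<pi> a)" and n: "a \<le> n" "odd (\<alpha> l (\<pi> n))" for a n l
    proof -
      define dom where "dom m \<longleftrightarrow> (\<exists>s\<ge>a. \<alpha> l (\<pi> m) < \<alpha> l (\<pi> s))" for m
      \<comment> \<open>Odd priorities since \<open>a\<close> are bounded by the current vector
        unless already exceeded, and membership of \<open>l\<close> in the current set is witnessed
        by a priority reaching the current bound. A round end makes the set full, so the witness
        then exists for \<open>l\<close>.\<close>
      define inv where "inv t \<longleftrightarrow>
        (\<forall>m\<in>{a..t}. odd (\<alpha> l (\<pi> m)) \<longrightarrow> \<alpha> l (\<pi> m) \<le> (P ! i t) l \<or> dom m) \<and>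
        (l \<in> N t \<longrightarrow> (\<exists>s\<ge>a. (P ! i t) l \<le> \<alpha> l (\<pi> s)))" for t
      have new: "\<alpha> l (\<pi> t) \<le> (P ! i t) l" if "odd (\<alpha> l (\<pi> t))" for t
        using safe_I[OF I] that by (auto simp: safe_def)
      have seen: "(P ! i t) l \<le> \<alpha> l (\<pi> t)" if "l \<in> seen_even \<alpha> (P ! i t) (\<pi> t)" for t
        using that by (simp add: seen_even_def)
      have end_dom: "dom m"
        if inv: "inv t" and e: "round_end (\<rho> t) (\<rho> (Suc t))" and t: "a \<le> t"
          and m: "m \<in> {a..Suc t}" "odd (\<alpha> l (\<pi> m))" for t m
      proof -
        have "l \<in> N t \<union> seen_even \<alpha> (P ! i t) (\<pi> (Suc t))"
          using e by (auto simp: round_end_def \<rho> M_def)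
        then obtain s where s: "s \<ge> a" "(P ! i t) l \<le> \<alpha> l (\<pi> s)"
          using inv t unfolding inv_def seen_even_def by (auto intro: le_SucI)
        have "\<alpha> l (\<pi> m) \<le> (P ! i t) l \<or> dom m"
          using inv e m by (auto simp: inv_def round_end_def \<rho> safe_def le_Suc_eq)
        \<comment> \<open>Parity makes the bound strict.\<close>
        moreover have "\<alpha> l (\<pi> m) \<noteq> (P ! i t) l"
          using even_P[OF i_bound] m(2) by metis
        ultimately have "\<alpha> l (\<pi> m) < \<alpha> l (\<pi> s) \<or> dom m"
          using s(2) by linarith
        then show ?thesis
          using s(1) unfolding dom_def by blast
      qed
      have inv: "inv t" if "a \<le> t" for t
        using that
      proof (induction t rule: dec_induct)
        case base
        then show ?case
          using new seen start by (auto simp: inv_def)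
      next
        case (step t)
        consider "round_end (\<rho> t) (\<rho> (Suc t))" | "climb (\<rho> t) (\<rho> (Suc t))" | "continue (\<rho> t) (\<rho> (Suc t))"
          using run by (auto simp: step_def)
        then show ?case
        proof cases
          case 1
          then show ?thesis
            using end_dom[OF step.IH 1] seen[of "Suc t"] step.hyps
            by (auto simp: inv_def round_end_def \<rho> intro: le_SucI)
        next
          case 2
          \<comment> \<open>The vector grows, so old bounds persist; the old witnesses may fall
            below it, which is why the set is reset.\<close>
          then have "(P ! i t) l \<le> (P ! i (Suc t)) l"
            using desc_P[of "i (Suc t)" "i t"] i_bound by (simp add: climb_def \<rho>)
          then have "\<alpha> l (\<pi> m) \<le> (P ! i (Suc t)) l \<or> dom m" if "m \<in> {a..t}" "odd (\<alpha> l (\<pi> m))" for m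
            using step.IH that unfolding inv_def by (meson le_trans)
          moreover have "l \<in> N (Suc t) \<longrightarrow> (P ! i (Suc t)) l \<le> \<alpha> l (\<pi> (Suc t))"
            using 2 seen[of "Suc t"] by (simp add: climb_def \<rho>)
          ultimately show ?thesis
            using new[of "Suc t"] step.hyps unfolding inv_def
            by (metis atLeastAtMost_iff le_SucE le_SucI)
        next
          case 3
          then show ?thesis
            using step.IH step.hyps new[of "Suc t"] seen[of "Suc t"]
            by (auto simp: inv_def continue_def \<rho> M_def le_Suc_eq intro: exI[of _ "Suc t"])
        qed
      qed
      obtain t where "t \<ge> n" "round_end (\<rho> t) (\<rho> (Suc t))"
        using often by blast
      then show ?thesis
        using end_dom[of t n] inv[of t] n by (auto simp: dom_def)
    qed
    show "\<pi> \<in> ConjEvenParity G \<alpha>"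
    proof (rule ConjEvenParity_of_domination[OF G \<pi>])
      fix K
      obtain t where t: "t \<ge> K" "round_end (\<rho> t) (\<rho> (Suc t))"
        using often by blast
      then have "N (Suc t) = seen_even \<alpha> (P ! i (Suc t)) (\<pi> (Suc t))"
        by (simp add: round_end_def \<rho>)
      then show "\<exists>a\<ge>K. \<forall>l. \<forall>n\<ge>a. odd (\<alpha> l (\<pi> n)) \<longrightarrow> (\<exists>s\<ge>a. \<alpha> l (\<pi> n) < \<alpha> l (\<pi> s))"
        using t(1) dominated by (intro exI[of _ "Suc t"]) auto
    qed
  qed
  then show "v0 \<in> Win G Player0 (ConjEvenParity G \<alpha>)"
    by simp
qed

section \<open>Evenness and descent of the chain\<close>

lemma chain_above_even:
  fixes d q :: "'k \<Rightarrow> nat"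
  assumes "\<And>l. even (q l)" "i < length (chain_above d q)"
  shows "even ((chain_above d q ! i) l)"
proof -
  have "even (top_even d l)" for l
    unfolding top_even_def using Max_in[of "{m \<in> {0..d l}. even m}"] by fastforce
  then have "even ((minus_two q ^^ j) (top_even d) l)" for j l
    using assms(1) by (induction j arbitrary: l) (auto simp: minus_two_def max_def)
  then show ?thesis
    using assms(2) by (simp add: chain_above_def del: upt_Suc)
qed

lemma chain_above_antimono:
  fixes d q :: "'k \<Rightarrow> nat"
  assumes q: "\<And>l. even (q l) \<and> q l \<in> {0..d l}"
    and "i \<le> j" "j < length (chain_above d q)"
  shows "(chain_above d q ! j) l \<le> (chain_above d q ! i) l"
proof -
  have "q l \<le> top_even d l"
    unfolding top_even_def using q by (intro Max_ge) auto
  \<comment> \<open>The maximum with \<open>q l\<close> could raise a coordinate lying below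
    \<open>q l\<close>; this bound excludes that.\<close>
  then have ge: "q l \<le> (minus_two q ^^ n) (top_even d) l" for n
    by (cases n) (auto simp: minus_two_def)
  have "(minus_two q ^^ Suc n) (top_even d) l \<le> (minus_two q ^^ n) (top_even d) l" for n
    using ge[of n] by (simp add: minus_two_def)
  then have "(minus_two q ^^ j) (top_even d) l \<le> (minus_two q ^^ i) (top_even d) l"
    using assms(2) by (rule lift_Suc_antimono_le)
  then show ?thesis
    using assms(2,3) by (simp add: chain_above_def del: upt_Suc)
qed

theorem proposition17:
  fixes G :: "'v game"
    and \<alpha> :: "'k::finite \<Rightarrow> 'v \<Rightarrow> nat"
    and d q :: "'k \<Rightarrow> nat"
    and v\<^sub>0 :: 'v
  assumes "game_structure G"
    and "\<And>l v. v \<in> verts G \<Longrightarrow> \<alpha> l v \<in> {0..d l}"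
    and "\<And>l. even (q l) \<and> q l \<in> {0..d l}"
    and "v\<^sub>0 \<in> verts G"
    and "v\<^sub>0 \<in> Attr0 G (LayEp0 G \<alpha> (chain_above d q))"
  shows "v\<^sub>0 \<in> Win G Player0 (ConjEvenParity G \<alpha>)"
proof (rule Win_of_Attr0[OF assms(1,5)])
  show "LayEp0 G \<alpha> (chain_above d q) \<subseteq> Win G Player0 (ConjEvenParity G \<alpha>)"
  proof (rule postfixpoint_LayAttr0_subset_Win[OF assms(1)])
    show "LayEp0 G \<alpha> (chain_above d q) \<subseteq>
        LayAttr0 G \<alpha> (chain_above d q) (LayEp0 G \<alpha> (chain_above d q))"
      using assms(1) by (intro LayEp0_fixpoint) (simp add: game_structure_def)
    show "chain_above d q \<noteq> []"
      by (simp add: chain_above_def)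
    show "even ((chain_above d q ! i) l)" if "i < length (chain_above d q)" for i l
      using assms(3) that by (intro chain_above_even) auto
    show "(chain_above d q ! j) l \<le> (chain_above d q ! i) l"
      if "i \<le> j" "j < length (chain_above d q)" for i j l
      using assms(3) that by (rule chain_above_antimono)
  qed
qed (rule ConjEvenParity_of_suffix)

end
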